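(* Let $X$ be a real infinite-dimensional Banach space and $\kappa$ an uncountable regular cardinal. Then $X$ admits a $1$-suppression unconditional basic sequence of length $\kappa$ if and only if the player has a winning strategy in the following one-player game of length $\kappa$ on $X$. At stage $\alpha<\kappa$ the player chooses a pair $(x_\alpha,Z_\alpha)$, where $x_\alpha\in X$, $\|x_\alpha\|=1$, and $Z_\alpha\subset X$ is a closed linear subspace, subject to the rules: (1) $Z_\beta\subset Z_\alpha$ for $\alpha<\beta$; (2) $x_\alpha\in\bigcap_{\gamma<\alpha}Z_\gamma$; (3) $[x_\gamma:\gamma<\alpha]+Z_\alpha\subset\Psi([x_\alpha]^\perp)$. If the player cannot make an inning at some stage $\alpha<\kappa$, the game ends and she loses; if she can play $\kappa$ many innings, she wins.
   Context: $[\,\cdot\,]$ denotes closed linear span and $[x]^\perp=\{f\in X^*:f(x)=0\}$. For $U\subset X^*$ put $$\Psi(U)=\Big\{x\in X:\ \sup_{f\in U\setminus\{0\}}\frac{|f(x)|}{\|f\|}=\|x\|\Big\},\qquad \Psi(\emptyset)=\Psi(\{0\})=\{0\}.$$ The empty intersection in rule (2) (at $\alpha=0$) is $X$. A sequence $\{e_\alpha\}_{\alpha<\kappa}$ of norm-one vectors is a $1$-suppression unconditional basic sequence if $\|\sum_{\alpha\in A}c_\alpha e_\alpha\|\le\|\sum_{\alpha\in B}c_\alpha e_\alpha\|$ for all finite $A\subset B\subset\kappa$ and all $c_\alpha\in\mathbb{R}$, $\alpha\in B$. *)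

theory Defs
  imports "HOL-Analysis.Analysis"
begin

definition infinite_dimensional :: "'a::real_vector itself \<Rightarrow> bool" where
  "infinite_dimensional _ \<longleftrightarrow> \<not> (\<exists>B :: 'a set. finite B \<and> span B = UNIV)"

definition annihilator :: "'a::real_normed_vector \<Rightarrow> ('a \<Rightarrow>\<^sub>L real) set" where
  "annihilator x = {f. blinfun_apply f x = 0}"

(* The quotients are bounded by norm x, so the real-valued supremum is the genuine one
   whenever U - {0} is nonempty; the other case is fixed by convention. *)
definition Psi :: "('a::real_normed_vector \<Rightarrow>\<^sub>L real) set \<Rightarrow> 'a set" where
  "Psi U = (if U - {0} = {} then {0}
            else {x. (SUP f\<in>U - {0}. \<bar>blinfun_apply f x\<bar> / norm f) = norm x})"

definition closed_span :: "'a::real_normed_vector set \<Rightarrow> 'a set" where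
  "closed_span S = closure (span S)"

(* A cardinal kappa is a well-order in the sense of Card_order; its elements, the ordinals
   alpha < kappa, are the members of Field kappa, and {gamma. gamma < alpha} is
   underS kappa alpha. *)

definition suppression_unconditional_basic ::
    "'k rel \<Rightarrow> ('k \<Rightarrow> 'a::real_normed_vector) \<Rightarrow> bool" where
  "suppression_unconditional_basic \<kappa> e \<longleftrightarrow>
     (\<forall>\<alpha>\<in>Field \<kappa>. norm (e \<alpha>) = 1) \<and>
     (\<forall>A B (c :: 'k \<Rightarrow> real). finite B \<and> A \<subseteq> B \<and> B \<subseteq> Field \<kappa> \<longrightarrow>
        norm (\<Sum>\<alpha>\<in>A. c \<alpha> *\<^sub>R e \<alpha>) \<le> norm (\<Sum>\<alpha>\<in>B. c \<alpha> *\<^sub>R e \<alpha>))"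

(* An inning is a pair (x, Z). In legal_inning the history h is only consulted at stages
   before alpha. *)

type_synonym 'a inning = "'a \<times> 'a set"

definition legal_inning ::
    "'k rel \<Rightarrow> ('k \<Rightarrow> 'a::real_normed_vector inning) \<Rightarrow> 'k \<Rightarrow> 'a inning \<Rightarrow> bool" where
  "legal_inning \<kappa> h \<alpha> = (\<lambda>(x, Z).
     norm x = 1 \<and> closed Z \<and> subspace Z \<and>
     (\<forall>\<gamma>\<in>underS \<kappa> \<alpha>. Z \<subseteq> snd (h \<gamma>)) \<and>
     x \<in> (\<Inter>\<gamma>\<in>underS \<kappa> \<alpha>. snd (h \<gamma>)) \<and>
     {u + z |u z. u \<in> closed_span ((\<lambda>\<gamma>. fst (h \<gamma>)) ` underS \<kappa> \<alpha>) \<and> z \<in> Z}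
       \<subseteq> Psi (annihilator x))"

(* A strategy prescribes the next inning from the current stage and the innings made
   before it. Prescribing an illegal inning means losing at that stage. *)

type_synonym ('k, 'a) strategy = "'k \<Rightarrow> ('k \<Rightarrow> 'a inning) \<Rightarrow> 'a inning"

definition follows ::
    "'k rel \<Rightarrow> ('k, 'a) strategy \<Rightarrow> ('k \<Rightarrow> 'a inning) \<Rightarrow> bool" where
  "follows \<kappa> \<sigma> p \<longleftrightarrow> (\<forall>\<alpha>\<in>Field \<kappa>. p \<alpha> = \<sigma> \<alpha> (restrict p (underS \<kappa> \<alpha>)))"

definition winning_strategy ::
    "'k rel \<Rightarrow> ('k, 'a::real_normed_vector) strategy \<Rightarrow> bool" where
  "winning_strategy \<kappa> \<sigma> \<longleftrightarrow>
     (\<forall>p. follows \<kappa> \<sigma> p \<longrightarrow> (\<forall>\<alpha>\<in>Field \<kappa>. legal_inning \<kappa> p \<alpha> (p \<alpha>)))"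

(* Every strategy is followed by some play, so winning_strategy is never vacuously true. *)
lemma follows_exists:
  assumes "Well_order \<kappa>"
  shows "\<exists>p. follows \<kappa> \<sigma> p"
proof -
  interpret wo_rel \<kappa> using assms by (simp add: wo_rel_def)
  let ?H = "\<lambda>p \<alpha>. \<sigma> \<alpha> (restrict p (underS \<alpha>))"
  have "adm_wo ?H"
    unfolding adm_wo_def by (metis restrict_ext)
  then have "worec ?H = ?H (worec ?H)"
    by (rule worec_fixpoint)
  then have "follows \<kappa> \<sigma> (worec ?H)"
    unfolding follows_def by (metis (no_types, lifting))
  then show ?thesis by blast
qed

end

theory Submission
  imports Defs
begin

text \<open>By the Hahn--Banach theorem, a vector \<open>w\<close> lies in \<open>\<Psi>([x]\<^sup>\<bottom>)\<close> if and only if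
  \<open>\<parallel>w\<parallel> \<le> \<parallel>w + c x\<parallel>\<close> for all scalars \<open>c\<close>. Given a basic sequence \<open>e\<close>, the player therefore wins with
  \<open>x\<^sub>\<alpha> = e\<^sub>\<alpha>\<close> and \<open>Z\<^sub>\<alpha> = [e\<^sub>\<gamma> : \<gamma> > \<alpha>]\<close>. Conversely, the vectors of a winning play form a basic sequence:
  since \<open>x\<^sub>\<beta> \<in> Z\<^sub>\<alpha>\<close> for \<open>\<beta> > \<alpha>\<close>, rule (3) says that dropping the term of index \<open>\<alpha>\<close> from a finite sum
  does not increase its norm, and the terms can be dropped one at a time.\<close>

subsection \<open>Hahn--Banach extension by minimal sublinear functionals\<close>

definition sublinear :: "('a::real_vector \<Rightarrow> real) \<Rightarrow> bool" where
  "sublinear p \<longleftrightarrow> (\<forall>x y. p (x + y) \<le> p x + p y) \<and> (\<forall>t\<ge>0. \<forall>x. p (t *\<^sub>R x) = t * p x)"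

lemma sublinear_add: "sublinear p \<Longrightarrow> p (x + y) \<le> p x + p y"
  by (simp add: sublinear_def)

lemma sublinear_scale: "sublinear p \<Longrightarrow> 0 \<le> t \<Longrightarrow> p (t *\<^sub>R x) = t * p x"
  by (simp add: sublinear_def)

lemma sublinear_0: "sublinear p \<Longrightarrow> p 0 = 0"
  using sublinear_scale[of p 0 0] by simp

lemma sublinear_minus: "sublinear p \<Longrightarrow> - p (- x) \<le> p x"
  using sublinear_add[of p x "- x"] sublinear_0[of p] by simp

lemma sublinear_norm: "sublinear norm"
  by (simp add: sublinear_def norm_triangle_ineq)

text \<open>The bound for \<open>inverse t\<close> at \<open>t *\<^sub>R x\<close> is the reverse of
  the bound for \<open>t\<close> at \<open>x\<close>, so one inequality for positive
  \<open>t\<close> already gives homogeneity.\<close>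

lemma sublinearI:
  assumes add: "\<And>x y. p (x + y) \<le> p x + p y"
    and zero: "p 0 = 0"
    and scale: "\<And>t x. 0 < t \<Longrightarrow> p (t *\<^sub>R x) \<le> t * p x"
  shows "sublinear p"
proof -
  have "p (t *\<^sub>R x) = t * p x" if "0 \<le> t" for t x
  proof (cases "t = 0")
    case False
    with that have t: "0 < t" by simp
    have "p x \<le> inverse t * p (t *\<^sub>R x)"
      using scale[of "inverse t" "t *\<^sub>R x"] t by simp
    then have "t * p x \<le> p (t *\<^sub>R x)"
      using t by (simp add: field_simps)
    with scale[OF t] show ?thesis by (simp add: antisym)
  qed (simp add: zero)
  with add show ?thesis by (simp add: sublinear_def)
qed

text \<open>A linear functional below the infimum in this lemma is at least \<open>r\<close> at \<open>v\<close>
  for every \<open>(v, r) \<in> S\<close>.\<close>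

lemma sublinear_inf_cone:
  fixes p :: "'a::real_vector \<Rightarrow> real"
  assumes p: "sublinear p"
    and below: "\<And>v r. (v, r) \<in> S \<Longrightarrow> r \<le> p v"
    and zero: "(0, 0) \<in> S"
    and add: "\<And>v r w s. (v, r) \<in> S \<Longrightarrow> (w, s) \<in> S \<Longrightarrow> (v + w, r + s) \<in> S"
    and scale: "\<And>t v r. 0 < t \<Longrightarrow> (v, r) \<in> S \<Longrightarrow> (t *\<^sub>R v, t * r) \<in> S"
  obtains q where "sublinear q" "\<And>x. q x \<le> p x" "\<And>v r. (v, r) \<in> S \<Longrightarrow> q (- v) \<le> - r"
proof
  define q where "q = (\<lambda>x. INF (v, r)\<in>S. p (x + v) - r)"
  \<comment> \<open>By \<open>below\<close>, \<open>r \<le> p v \<le> p (x + v) + p (- x)\<close>.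
    The bound does not depend on \<open>(v, r)\<close>, so \<open>q\<close> is a genuine
    infimum.\<close>
  have lower: "- p (- x) \<le> p (x + v) - r" if "(v, r) \<in> S" for x v r
    using below[OF that] sublinear_add[OF p, of "x + v" "- x"] by simp
  then have bdd: "bdd_below ((\<lambda>(v, r). p (x + v) - r) ` S)" for x
    by (intro bdd_belowI2[where m = "- p (- x)"]) auto
  have le: "q x \<le> p (x + v) - r" if "(v, r) \<in> S" for x v r
    unfolding q_def using cINF_lower[OF bdd that] by simp
  have ge: "b \<le> q x" if "\<And>v r. (v, r) \<in> S \<Longrightarrow> b \<le> p (x + v) - r" for b x
    unfolding q_def using zero that by (intro cINF_greatest) auto
  show "q x \<le> p x" for x
    using le[OF zero] by simp
  show "q (- v) \<le> - r" if "(v, r) \<in> S" for v r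
    using le[OF that, of "- v"] sublinear_0[OF p] by simp
  show "sublinear q"
  proof (rule sublinearI)
    show "q (x + y) \<le> q x + q y" for x y
    proof -
      \<comment> \<open>For fixed \<open>(v, r)\<close> the infimum is taken over
        \<open>(w, s)\<close>, and only then over \<open>(v, r)\<close>. The sum of the two pairs is
        in \<open>S\<close> and so competes in the infimum at \<open>x + y\<close>.\<close>
      have "q (x + y) - q y \<le> p (x + v) - r" if S: "(v, r) \<in> S" for v r
      proof -
        have "q (x + y) - (p (x + v) - r) \<le> p (y + w) - s" if "(w, s) \<in> S" for w s
          using le[OF add[OF S that], of "x + y"] sublinear_add[OF p, of "x + v" "y + w"]
          by (simp add: algebra_simps)
        then have "q (x + y) - (p (x + v) - r) \<le> q y" by (rule ge)
        then show ?thesis by simp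
      qed
      then have "q (x + y) - q y \<le> q x" by (rule ge)
      then show ?thesis by simp
    qed
    show "q 0 = 0"
      using le[OF zero, of 0] ge[of 0 0] below sublinear_0[OF p] by force
    show "q (t *\<^sub>R x) \<le> t * q x" if t: "0 < t" for t x
    proof -
      have "q (t *\<^sub>R x) / t \<le> p (x + v) - r" if "(v, r) \<in> S" for v r
      proof -
        have "q (t *\<^sub>R x) \<le> p (t *\<^sub>R (x + v)) - t * r"
          using le[OF scale[OF t that]] by (simp add: scaleR_add_right)
        also have "\<dots> = t * (p (x + v) - r)"
          using sublinear_scale[OF p, of t "x + v"] t by (simp add: algebra_simps)
        finally show ?thesis using t by (simp add: field_simps)
      qed
      then have "q (t *\<^sub>R x) / t \<le> q x" by (rule ge)
      with t show ?thesis by (simp add: field_simps)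
    qed
  qed
qed

text \<open>Supplies the bounds of chains for Zorn's lemma. An infimum of sublinear functionals need
  not be subadditive, but in a chain the smaller of \<open>q\<close> and \<open>q'\<close> serves at
  both \<open>x\<close> and \<open>y\<close>.\<close>

lemma sublinear_inf_chain:
  assumes "C \<noteq> {}" and sub: "\<And>q. q \<in> C \<Longrightarrow> sublinear q"
    and le: "\<And>q x. q \<in> C \<Longrightarrow> q x \<le> p x"
    and chain: "\<And>q q'. q \<in> C \<Longrightarrow> q' \<in> C \<Longrightarrow> q \<le> q' \<or> q' \<le> q"
  obtains u where "sublinear u" "\<And>q x. q \<in> C \<Longrightarrow> u x \<le> q x"
proof
  define u where "u = (\<lambda>x. INF q\<in>C. q x)"
  have "- p (- x) \<le> q x" if "q \<in> C" for q x
    using sublinear_minus[OF sub[OF that], of x] le[OF that, of "- x"] by simp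
  then have bdd: "bdd_below ((\<lambda>q. q x) ` C)" for x
    by (rule bdd_belowI2)
  show lower: "u x \<le> q x" if "q \<in> C" for q x
    unfolding u_def using cINF_lower[OF bdd that] .
  have greatest: "b \<le> u x" if "\<And>q. q \<in> C \<Longrightarrow> b \<le> q x" for b x
    unfolding u_def using assms(1) that by (rule cINF_greatest)
  show "sublinear u"
  proof (rule sublinearI)
    show "u (x + y) \<le> u x + u y" for x y
    proof -
      have "u (x + y) - u y \<le> q x" if q: "q \<in> C" for q
      proof -
        have "u (x + y) - q x \<le> q' y" if q': "q' \<in> C" for q'
          using chain[OF q q']
        proof
          assume "q \<le> q'"
          then show ?thesis
            using lower[OF q, of "x + y"] sublinear_add[OF sub[OF q], of x y] le_funD[of q q' y]
            by simp
        next
          assume "q' \<le> q"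
          then show ?thesis
            using lower[OF q', of "x + y"] sublinear_add[OF sub[OF q'], of x y] le_funD[of q' q x]
            by simp
        qed
        then have "u (x + y) - q x \<le> u y" by (rule greatest)
        then show ?thesis by simp
      qed
      then have "u (x + y) - u y \<le> u x" by (rule greatest)
      then show ?thesis by simp
    qed
    show "u 0 = 0"
      using assms(1) by (simp add: u_def sublinear_0[OF sub])
    show "u (t *\<^sub>R x) \<le> t * u x" if t: "0 < t" for t x
    proof -
      have "u (t *\<^sub>R x) / t \<le> q x" if q: "q \<in> C" for q
        using lower[OF q, of "t *\<^sub>R x"] sublinear_scale[OF sub[OF q], of t x] t
        by (simp add: field_simps)
      then have "u (t *\<^sub>R x) / t \<le> u x" by (rule greatest)
      with t show ?thesis by (simp add: field_simps)
    qed
  qed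
qed

text \<open>A minimal sublinear functional below \<open>p\<close> is odd, since otherwise an infimum
  over a ray would produce a smaller one. Odd sublinear functionals are linear.\<close>

theorem sublinear_dominates_linear:
  fixes p :: "'a::real_vector \<Rightarrow> real"
  assumes "sublinear p"
  obtains f where "linear f" "\<And>x. f x \<le> p x"
proof -
  define A where "A = {q. sublinear q \<and> q \<le> p}"
  \<comment> \<open>The relation reverses the pointwise order, so that Zorn's lemma yields a minimal
    element.\<close>
  have "\<exists>m\<in>A. \<forall>q\<in>A. q \<le> m \<longrightarrow> q = m"
  proof (rule predicate_Zorn)
    show "partial_order_on A (relation_of (\<lambda>q q'. q' \<le> q) A)"
      by (auto simp: partial_order_on_def preorder_on_def refl_on_def trans_def antisym_def
          relation_of_def)
    fix C assume "C \<in> Chains (relation_of (\<lambda>q q'. q' \<le> q) A)"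
    then have C: "C \<subseteq> A" and chain: "\<And>q q'. q \<in> C \<Longrightarrow> q' \<in> C \<Longrightarrow> q \<le> q' \<or> q' \<le> q"
      by (auto simp: Chains_def relation_of_def)
    show "\<exists>u\<in>A. \<forall>q\<in>C. u \<le> q"
    proof (cases "C = {}")
      case True
      with assms show ?thesis by (auto simp: A_def)
    next
      case False
      have "\<And>q. q \<in> C \<Longrightarrow> sublinear q" "\<And>q x. q \<in> C \<Longrightarrow> q x \<le> p x"
        using C by (auto simp: A_def le_fun_def)
      then obtain u where u: "sublinear u" "\<And>q x. q \<in> C \<Longrightarrow> u x \<le> q x"
        using sublinear_inf_chain[of C p] False chain by blast
      obtain q where "q \<in> C"
        using False by blast
      with u C have "u \<le> q" "q \<le> p"
        by (auto simp: A_def le_fun_def)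
      then have "u \<in> A"
        using u(1) by (simp add: A_def)
      with u show ?thesis by (auto simp: le_fun_def)
    qed
  qed
  then obtain m where m: "sublinear m" and le: "m \<le> p"
    and minimal: "\<And>q. sublinear q \<Longrightarrow> q \<le> m \<Longrightarrow> q = m"
    unfolding A_def using order_trans by blast
  have neg: "m (- y) = - m y" for y
  proof -
    \<comment> \<open>The ray through \<open>(y, m y)\<close>. The resulting \<open>q\<close> lies
      below \<open>m\<close>, hence equals \<open>m\<close>, and its bound for \<open>t = 1\<close>
      becomes \<open>m (- y) \<le> - m y\<close>.\<close>
    define S where "S = {(t *\<^sub>R y, t * m y) |t. 0 \<le> t}"
    obtain q where q: "sublinear q" "\<And>x. q x \<le> m x" "\<And>v r. (v, r) \<in> S \<Longrightarrow> q (- v) \<le> - r"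
    proof (rule sublinear_inf_cone[OF m, of S])
      show "r \<le> m v" if "(v, r) \<in> S" for v r
        using that by (auto simp: S_def sublinear_scale[OF m])
      show "(0, 0) \<in> S"
        by (auto simp: S_def)
      show "(v + w, r + s) \<in> S" if vr: "(v, r) \<in> S" and ws: "(w, s) \<in> S" for v r w s
      proof -
        obtain t t' where "0 \<le> t" "0 \<le> t'" "v = t *\<^sub>R y" "r = t * m y" "w = t' *\<^sub>R y" "s = t' * m y"
          using vr ws by (auto simp: S_def)
        then show ?thesis
          unfolding S_def by (intro CollectI exI[of _ "t + t'"]) (simp add: algebra_simps)
      qed
      show "(t *\<^sub>R v, t * r) \<in> S" if "0 < t" and vr: "(v, r) \<in> S" for t v r
      proof -
        obtain t' where "0 \<le> t'" "v = t' *\<^sub>R y" "r = t' * m y"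
          using vr by (auto simp: S_def)
        with \<open>0 < t\<close> show ?thesis
          unfolding S_def by (intro CollectI exI[of _ "t * t'"]) simp
      qed
    qed blast
    have "q = m"
      using q by (intro minimal) (auto simp: le_fun_def)
    moreover have "(y, m y) \<in> S"
      unfolding S_def by (intro CollectI exI[of _ 1]) simp
    ultimately have "m (- y) \<le> - m y"
      using q(3) by blast
    with sublinear_minus[OF m, of y] show ?thesis by simp
  qed
  have "linear m"
  proof (rule linearI)
    \<comment> \<open>Subadditivity at \<open>- x\<close> and \<open>- y\<close> turns into the
      reverse inequality because \<open>m\<close> is odd.\<close>
    show "m (x + y) = m x + m y" for x y
      using sublinear_add[OF m, of x y] sublinear_add[OF m, of "- x" "- y"] neg[of "x + y"]
      by (simp add: neg)
    show "m (c *\<^sub>R x) = c *\<^sub>R m x" for c x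
    proof (cases "0 \<le> c")
      case False
      then show ?thesis
        using sublinear_scale[OF m, of "- c" x] neg[of "c *\<^sub>R x"] by simp
    qed (simp add: sublinear_scale[OF m])
  qed
  with le show thesis
    by (intro that) (auto simp: le_fun_def)
qed

text \<open>By \<open>orth\<close>, the value \<open>t * norm w\<close> prescribed at
  \<open>c *\<^sub>R x + t *\<^sub>R w\<close> for \<open>t \<ge> 0\<close> never exceeds the norm,
  so the cone construction applies to the norm.\<close>

lemma norming_functional:
  fixes w x :: "'a::real_normed_vector"
  assumes w: "w \<noteq> 0" and orth: "\<And>c. norm w \<le> norm (w + c *\<^sub>R x)"
  obtains f :: "'a \<Rightarrow>\<^sub>L real"
  where "norm f = 1" "blinfun_apply f w = norm w" "blinfun_apply f x = 0"
proof -
  \<comment> \<open>Since \<open>c\<close> may have either sign, the functional is nonnegative at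
    both \<open>x\<close> and \<open>- x\<close>, hence zero at \<open>x\<close>. The choice
    \<open>c = 0\<close>, \<open>t = 1\<close> makes it reach \<open>norm w\<close> at
    \<open>w\<close>.\<close>
  define S where "S = {(c *\<^sub>R x + t *\<^sub>R w, t * norm w) |c t. 0 \<le> t}"
  obtain q where q: "sublinear q" "\<And>v. q v \<le> norm v" "\<And>v r. (v, r) \<in> S \<Longrightarrow> q (- v) \<le> - r"
  proof (rule sublinear_inf_cone[OF sublinear_norm, of S])
    show "r \<le> norm v" if vr: "(v, r) \<in> S" for v r
    proof -
      obtain c t where v: "v = c *\<^sub>R x + t *\<^sub>R w" and r: "r = t * norm w" and t: "0 \<le> t"
        using vr by (auto simp: S_def)
      show ?thesis
      proof (cases "t = 0")
        case False
        have "r \<le> t * norm (w + (c / t) *\<^sub>R x)"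
          unfolding r using orth t by (intro mult_left_mono)
        also have "\<dots> = norm (t *\<^sub>R (w + (c / t) *\<^sub>R x))"
          using t by simp
        also have "t *\<^sub>R (w + (c / t) *\<^sub>R x) = v"
          using False by (simp add: v scaleR_add_right)
        finally show ?thesis .
      qed (simp add: r)
    qed
    show "(0, 0) \<in> S"
      unfolding S_def by (intro CollectI exI[of _ 0]) simp
    show "(v + v', r + r') \<in> S" if vr: "(v, r) \<in> S" "(v', r') \<in> S" for v r v' r'
    proof -
      obtain c t c' t' where "v = c *\<^sub>R x + t *\<^sub>R w" "r = t * norm w" "0 \<le> t"
        "v' = c' *\<^sub>R x + t' *\<^sub>R w" "r' = t' * norm w" "0 \<le> t'"
        using vr by (auto simp: S_def)
      then show ?thesis
        unfolding S_def
        by (intro CollectI exI[of _ "c + c'"] exI[of _ "t + t'"]) (simp add: algebra_simps)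
    qed
    show "(s *\<^sub>R v, s * r) \<in> S" if "0 < s" and vr: "(v, r) \<in> S" for s v r
    proof -
      obtain c t where "v = c *\<^sub>R x + t *\<^sub>R w" "r = t * norm w" "0 \<le> t"
        using vr by (auto simp: S_def)
      with \<open>0 < s\<close> show ?thesis
        unfolding S_def
        by (intro CollectI exI[of _ "s * c"] exI[of _ "s * t"]) (simp add: algebra_simps)
    qed
  qed blast
  obtain g where g: "linear g" "\<And>v. g v \<le> q v"
    using sublinear_dominates_linear[OF q(1)] by blast
  have gS: "r \<le> g v" if "(v, r) \<in> S" for v r
    using g(2)[of "- v"] q(3)[OF that] by (simp add: linear_neg[OF g(1)])
  have le: "g v \<le> norm v" for v
    using g(2) q(2) by (rule order_trans)
  have abs_le: "\<bar>g v\<bar> \<le> norm v" for v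
    using le[of v] le[of "- v"] by (simp add: linear_neg[OF g(1)] abs_le_iff)
  have "bounded_linear g"
    using g(1) by (rule bounded_linear.intro)
      (use abs_le in \<open>auto intro!: bounded_linear_axioms.intro exI[of _ 1]\<close>)
  then obtain f where f: "blinfun_apply f = g"
    using bounded_linear_Blinfun_apply by blast
  have gw: "g w = norm w"
  proof (rule antisym[OF le gS])
    show "(w, norm w) \<in> S"
      unfolding S_def by (intro CollectI exI[of _ 0] exI[of _ 1]) simp
  qed
  have S0: "(c *\<^sub>R x, 0) \<in> S" for c
    unfolding S_def by (intro CollectI exI[of _ c] exI[of _ 0]) simp
  have "0 \<le> g x" "0 \<le> g (- x)"
    using gS[OF S0[of 1]] gS[OF S0[of "- 1"]] by simp_all
  then have gx: "g x = 0"
    by (simp add: linear_neg[OF g(1)])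
  have "norm f \<le> 1"
    using abs_le by (intro norm_blinfun_bound) (auto simp: f)
  moreover have "1 \<le> norm f"
    using norm_blinfun[of f w] w by (simp add: f gw)
  ultimately show thesis
    using that[of f] by (simp add: f gw gx)
qed

subsection \<open>Orthogonality and the operator \<open>\<Psi>\<close>\<close>

lemma quotient_le_norm_shift:
  assumes "f \<in> annihilator x"
  shows "\<bar>blinfun_apply f w\<bar> / norm f \<le> norm (w + c *\<^sub>R x)"
proof -
  have "blinfun_apply f w = blinfun_apply f (w + c *\<^sub>R x)"
    using assms by (simp add: annihilator_def blinfun.bilinear_simps)
  then have "\<bar>blinfun_apply f w\<bar> \<le> norm f * norm (w + c *\<^sub>R x)"
    using norm_blinfun[of f "w + c *\<^sub>R x"] by simp
  \<comment> \<open>For \<open>f = 0\<close> the quotient is 0, by the convention on division by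
    zero.\<close>
  then show ?thesis
    by (cases "f = 0") (simp_all add: field_simps)
qed

lemma Psi_annihilatorD:
  assumes "w \<in> Psi (annihilator x)"
  shows "norm w \<le> norm (w + c *\<^sub>R x)"
\<comment> \<open>If the annihilator is trivial, the convention in \<open>Psi\<close> leaves only
  \<open>w = 0\<close>.\<close>
proof (cases "annihilator x - {0} = {}")
  case True
  with assms show ?thesis by (simp add: Psi_def)
next
  case False
  with assms have "norm w = (SUP f\<in>annihilator x - {0}. \<bar>blinfun_apply f w\<bar> / norm f)"
    by (simp add: Psi_def)
  also have "\<dots> \<le> norm (w + c *\<^sub>R x)"
    using False by (intro cSUP_least) (auto intro: quotient_le_norm_shift)
  finally show ?thesis .
qed

text \<open>The vector \<open>v\<close> serves to make the annihilator of \<open>x\<close> nontrivial, which matters for \<open>w = 0\<close>.\<close>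

lemma Psi_annihilatorI:
  fixes v w x :: "'a::real_normed_vector"
  assumes v: "v \<noteq> 0" "\<And>c. norm v \<le> norm (v + c *\<^sub>R x)"
    and w: "\<And>c. norm w \<le> norm (w + c *\<^sub>R x)"
  shows "w \<in> Psi (annihilator x)"
proof -
  obtain g :: "'a \<Rightarrow>\<^sub>L real" where "norm g = 1" "blinfun_apply g x = 0"
    using norming_functional[OF v] by blast
  then have g: "g \<in> annihilator x - {0}"
    by (auto simp: annihilator_def)
  \<comment> \<open>The supremum is attained: at a norming functional of \<open>w\<close>, or at any
    nonzero element of the annihilator if \<open>w = 0\<close>.\<close>
  have "\<exists>f\<in>annihilator x - {0}. \<bar>blinfun_apply f w\<bar> / norm f = norm w"
  proof (cases "w = 0")
    case True
    with g show ?thesis by (intro bexI[of _ g]) simp_all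
  next
    case False
    obtain f where "norm f = 1" "blinfun_apply f w = norm w" "blinfun_apply f x = 0"
      by (rule norming_functional[OF False w]) blast
    then show ?thesis
      by (intro bexI[of _ f]) (auto simp: annihilator_def)
  qed
  then obtain f where f: "f \<in> annihilator x - {0}" "\<bar>blinfun_apply f w\<bar> / norm f = norm w" by blast
  have bound: "\<bar>blinfun_apply h w\<bar> / norm h \<le> norm w" if "h \<in> annihilator x - {0}" for h
    using that quotient_le_norm_shift[of h x w 0] by simp
  have "(SUP h\<in>annihilator x - {0}. \<bar>blinfun_apply h w\<bar> / norm h) = norm w"
  proof (rule cSup_eq_maximum)
    show "norm w \<in> (\<lambda>h. \<bar>blinfun_apply h w\<bar> / norm h) ` (annihilator x - {0})"
      using f by force
  qed (use bound in auto)
  with g show ?thesis by (auto simp: Psi_def)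
qed

subsection \<open>Basic sequences and plays\<close>

text \<open>As \<open>e\<close> may fail to be injective, \<open>F\<close> is chosen with one index
  for each vector of the linear combination.\<close>

lemma span_image_sum:
  assumes "w \<in> span (e ` S)"
  obtains F c where "finite F" "F \<subseteq> S" "w = (\<Sum>i\<in>F. c i *\<^sub>R e i)"
proof -
  obtain T r where T: "finite T" "T \<subseteq> e ` S" and w: "w = (\<Sum>a\<in>T. r a *\<^sub>R a)"
    using assms by (auto simp: span_explicit)
  from T(2) obtain F where F: "F \<subseteq> S" "inj_on e F" "T = e ` F"
    by (auto simp: subset_image_inj)
  show thesis
  proof
    show "finite F"
      using F T(1) by (simp add: finite_image_iff)
    show "w = (\<Sum>i\<in>F. r (e i) *\<^sub>R e i)"
      using F by (simp add: w sum.reindex)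
  qed (rule F(1))
qed

text \<open>For a finite combination this is suppression of the single index
  \<open>\<alpha>\<close>. Both sides are continuous in \<open>w\<close>, so the inequality passes
  to the closure.\<close>

lemma suppression_unconditional_orthogonal:
  assumes e: "suppression_unconditional_basic \<kappa> e" and \<alpha>: "\<alpha> \<in> Field \<kappa>"
    and w: "w \<in> closed_span (e ` (Field \<kappa> - {\<alpha>}))"
  shows "norm w \<le> norm (w + c *\<^sub>R e \<alpha>)"
proof -
  let ?K = "{w. norm w \<le> norm (w + c *\<^sub>R e \<alpha>)}"
  have "norm w \<le> norm (w + c *\<^sub>R e \<alpha>)" if "w \<in> span (e ` (Field \<kappa> - {\<alpha>}))" for w
  proof -
    obtain F d where F: "finite F" "F \<subseteq> Field \<kappa> - {\<alpha>}" and w: "w = (\<Sum>i\<in>F. d i *\<^sub>R e i)"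
      using \<open>w \<in> span _\<close> by (rule span_image_sum)
    \<comment> \<open>As \<alpha> is not in \<open>F\<close>, the update keeps the sum over
      \<open>F\<close> and gives the new term the coefficient \<open>c\<close>.\<close>
    let ?d = "d(\<alpha> := c)"
    have "\<alpha> \<notin> F"
      using F by auto
    then have w': "w = (\<Sum>i\<in>F. ?d i *\<^sub>R e i)"
      unfolding w by (intro sum.cong) auto
    have "norm (\<Sum>i\<in>F. ?d i *\<^sub>R e i) \<le> norm (\<Sum>i\<in>insert \<alpha> F. ?d i *\<^sub>R e i)"
      using e F \<alpha> unfolding suppression_unconditional_basic_def
      by (meson Diff_subset finite_insert insert_subset order_trans subset_insertI)
    also have "(\<Sum>i\<in>insert \<alpha> F. ?d i *\<^sub>R e i) = w + c *\<^sub>R e \<alpha>"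
      using F(1) \<open>\<alpha> \<notin> F\<close> by (simp add: w' add.commute)
    finally show ?thesis by (simp add: w')
  qed
  then have "span (e ` (Field \<kappa> - {\<alpha>})) \<subseteq> ?K" by blast
  moreover have "closed ?K"
    by (intro closed_Collect_le continuous_intros)
  ultimately show ?thesis
    using w closure_minimal unfolding closed_span_def by blast
qed

lemma closed_span_mono: "S \<subseteq> T \<Longrightarrow> closed_span S \<subseteq> closed_span T"
  by (simp add: closed_span_def closure_mono span_mono)

lemma subspace_closed_span: "subspace (closed_span S)"
proof (intro subspaceI)
  show "0 \<in> closed_span S"
    unfolding closed_span_def using closure_subset span_zero by blast
  show "x + y \<in> closed_span S" if xy: "x \<in> closed_span S" "y \<in> closed_span S" for x y
  proof -
    obtain f g where "\<And>n. f n \<in> span S" "f \<longlonglongrightarrow> x" "\<And>n. g n \<in> span S" "g \<longlonglongrightarrow> y"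
      using xy by (auto simp: closed_span_def closure_sequential)
    then show ?thesis
      unfolding closed_span_def closure_sequential
      by (intro exI[of _ "\<lambda>n. f n + g n"]) (auto intro: span_add tendsto_add)
  qed
  show "c *\<^sub>R x \<in> closed_span S" if x: "x \<in> closed_span S" for c x
  proof -
    obtain f where "\<And>n. f n \<in> span S" "f \<longlonglongrightarrow> x"
      using x by (auto simp: closed_span_def closure_sequential)
    then show ?thesis
      unfolding closed_span_def closure_sequential
      by (intro exI[of _ "\<lambda>n. c *\<^sub>R f n"]) (auto intro: span_scale tendsto_scaleR)
  qed
qed

lemma subset_closed_span: "S \<subseteq> closed_span S"
  unfolding closed_span_def using closure_subset span_superset by blast

text \<open>The strategy ignores the history. Rules (1) and (2) come from transitivity of the order,
  and rule (3) holds because both spans involve only indices other than \<alpha>.\<close>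

lemma winning_strategyI:
  assumes \<kappa>: "Well_order \<kappa>" and unc: "uncountable (Field \<kappa>)"
    and e: "suppression_unconditional_basic \<kappa> e"
  shows "winning_strategy \<kappa> (\<lambda>\<alpha> h. (e \<alpha>, closed_span (e ` aboveS \<kappa> \<alpha>)))"
  unfolding winning_strategy_def
proof (intro allI impI ballI)
  interpret wo_rel \<kappa> using \<kappa> by (simp add: wo_rel_def)
  fix p \<alpha>
  assume follows: "follows \<kappa> (\<lambda>\<alpha> h. (e \<alpha>, closed_span (e ` aboveS \<alpha>))) p" and \<alpha>: "\<alpha> \<in> Field \<kappa>"
  have p: "p \<gamma> = (e \<gamma>, closed_span (e ` aboveS \<gamma>))" if "\<gamma> \<in> Field \<kappa>" for \<gamma>
    using follows that by (simp add: follows_def)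
  have under: "\<gamma> \<in> Field \<kappa>" "\<alpha> \<in> aboveS \<gamma>" "aboveS \<alpha> \<subseteq> aboveS \<gamma>" if "\<gamma> \<in> underS \<alpha>" for \<gamma>
    using that TRANS ANTISYM unfolding underS_def aboveS_def Field_def trans_def antisym_def
    by blast+
  have orth: "norm w \<le> norm (w + c *\<^sub>R e \<alpha>)"
    if "w \<in> closed_span (e ` (Field \<kappa> - {\<alpha>}))" for w c
    using e \<alpha> that by (rule suppression_unconditional_orthogonal)
  \<comment> \<open>A second index \<beta> is needed: \<open>e \<beta>\<close> is the nonzero vector
    \<open>v\<close> that \<open>Psi_annihilatorI\<close> asks for.\<close>
  have "infinite (Field \<kappa> - {\<alpha>})"
    using unc countable_finite by auto
  then obtain \<beta> where \<beta>: "\<beta> \<in> Field \<kappa> - {\<alpha>}"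
    by (metis finite.emptyI ex_in_conv)
  then have "norm (e \<beta>) = 1"
    using e by (simp add: suppression_unconditional_basic_def)
  then have e\<beta>: "e \<beta> \<noteq> 0" by auto
  have span\<beta>: "e \<beta> \<in> closed_span (e ` (Field \<kappa> - {\<alpha>}))"
    using \<beta> by (intro subsetD[OF subset_closed_span] imageI)
  have Psi: "u + z \<in> Psi (annihilator (e \<alpha>))"
    if u: "u \<in> closed_span (e ` underS \<alpha>)" and z: "z \<in> closed_span (e ` aboveS \<alpha>)" for u z
  proof -
    have "underS \<alpha> \<subseteq> Field \<kappa> - {\<alpha>}" "aboveS \<alpha> \<subseteq> Field \<kappa> - {\<alpha>}"
      by (auto simp: underS_def aboveS_def Field_def)
    then have "u \<in> closed_span (e ` (Field \<kappa> - {\<alpha>}))" "z \<in> closed_span (e ` (Field \<kappa> - {\<alpha>}))"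
      using u z by (auto dest: closed_span_mono[OF image_mono, THEN subsetD])
    then have "u + z \<in> closed_span (e ` (Field \<kappa> - {\<alpha>}))"
      by (rule subspace_add[OF subspace_closed_span])
    then show ?thesis
      by (intro Psi_annihilatorI[OF e\<beta>] orth span\<beta>)
  qed
  have fst: "(\<lambda>\<gamma>. fst (p \<gamma>)) ` underS \<alpha> = e ` underS \<alpha>"
    using under(1) by (intro image_cong) (simp_all add: p)
  have "norm (e \<alpha>) = 1"
    using e \<alpha> by (simp add: suppression_unconditional_basic_def)
  moreover have "closed (closed_span (e ` aboveS \<alpha>))"
    by (simp add: closed_span_def)
  moreover have "closed_span (e ` aboveS \<alpha>) \<subseteq> snd (p \<gamma>)" if "\<gamma> \<in> underS \<alpha>" for \<gamma>
    using under[OF that] by (simp add: p closed_span_mono image_mono)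
  moreover have "e \<alpha> \<in> snd (p \<gamma>)" if "\<gamma> \<in> underS \<alpha>" for \<gamma>
    using under[OF that] subset_closed_span[of "e ` aboveS \<gamma>"] by (auto simp: p)
  ultimately show "legal_inning \<kappa> p \<alpha> (p \<alpha>)"
    using Psi subspace_closed_span unfolding legal_inning_def p[OF \<alpha>] fst by auto
qed

lemma suppression_unconditional_of_play:
  fixes \<kappa> :: "'k rel" and p :: "'k \<Rightarrow> 'a::real_normed_vector inning"
  assumes \<kappa>: "Well_order \<kappa>"
    and legal: "\<And>\<alpha>. \<alpha> \<in> Field \<kappa> \<Longrightarrow> legal_inning \<kappa> p \<alpha> (p \<alpha>)"
  shows "suppression_unconditional_basic \<kappa> (\<lambda>\<alpha>. fst (p \<alpha>))"
  unfolding suppression_unconditional_basic_def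
proof (intro conjI ballI allI impI)
  interpret wo_rel \<kappa> using \<kappa> by (simp add: wo_rel_def)
  let ?x = "\<lambda>\<alpha>. fst (p \<alpha>)"
  show "norm (?x \<alpha>) = 1" if "\<alpha> \<in> Field \<kappa>" for \<alpha>
    using legal[OF that] by (auto simp: legal_inning_def split: prod.splits)
  have rule3: "u + z \<in> Psi (annihilator (?x \<alpha>))"
    if "\<alpha> \<in> Field \<kappa>" "u \<in> closed_span (?x ` underS \<alpha>)" "z \<in> snd (p \<alpha>)" for \<alpha> u z
    using legal[OF that(1)] that(2,3) by (fastforce simp: legal_inning_def split: prod.splits)
  have subsp: "subspace (snd (p \<alpha>))" if "\<alpha> \<in> Field \<kappa>" for \<alpha>
    using legal[OF that] by (auto simp: legal_inning_def split: prod.splits)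
  have rule2: "?x \<beta> \<in> snd (p \<alpha>)" if "\<beta> \<in> Field \<kappa>" "\<alpha> \<in> underS \<beta>" for \<alpha> \<beta>
    using legal[OF that(1)] that(2) by (auto simp: legal_inning_def split: prod.splits)
  have drop: "norm (\<Sum>i\<in>F. c i *\<^sub>R ?x i) \<le> norm (\<Sum>i\<in>insert \<alpha> F. c i *\<^sub>R ?x i)"
    if F: "finite F" "F \<subseteq> Field \<kappa>" and \<alpha>: "\<alpha> \<in> Field \<kappa>" "\<alpha> \<notin> F" for F \<alpha> and c :: "_ \<Rightarrow> real"
  proof -
    \<comment> \<open>Terms before \<alpha> form the part in the closed span of rule (3). The others
      come after \<alpha> and lie in its subspace by rule (2).\<close>
    let ?u = "\<Sum>i\<in>F \<inter> underS \<alpha>. c i *\<^sub>R ?x i" and ?z = "\<Sum>i\<in>F - underS \<alpha>. c i *\<^sub>R ?x i"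
    have "?u \<in> closed_span (?x ` underS \<alpha>)"
    proof (intro subspace_sum subspace_scale subspace_closed_span)
      show "?x i \<in> closed_span (?x ` underS \<alpha>)" if "i \<in> F \<inter> underS \<alpha>" for i
        using that by (intro subsetD[OF subset_closed_span] imageI) simp
    qed
    moreover have "?z \<in> snd (p \<alpha>)"
    proof (intro subspace_sum subspace_scale subsp \<alpha>)
      fix i assume i: "i \<in> F - underS \<alpha>"
      then have "\<alpha> \<in> underS i"
        using F \<alpha> TOTALS by (auto simp: underS_def)
      then show "?x i \<in> snd (p \<alpha>)"
        using i F by (intro rule2) auto
    qed
    ultimately have "?u + ?z \<in> Psi (annihilator (?x \<alpha>))"
      by (rule rule3[OF \<alpha>(1)])
    moreover have "?u + ?z = (\<Sum>i\<in>F. c i *\<^sub>R ?x i)"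
      using F(1) by (rule sum.Int_Diff[symmetric])
    ultimately have "(\<Sum>i\<in>F. c i *\<^sub>R ?x i) \<in> Psi (annihilator (?x \<alpha>))"
      by simp
    \<comment> \<open>The shift by \<open>c \<alpha>\<close> times the vector of index \<alpha>
      restores the dropped term.\<close>
    from Psi_annihilatorD[OF this, of "c \<alpha>"] show ?thesis
      using F(1) \<alpha>(2) by (simp add: add.commute)
  qed
  fix A B and c :: "'k \<Rightarrow> real"
  assume AB: "finite B \<and> A \<subseteq> B \<and> B \<subseteq> Field \<kappa>"
  \<comment> \<open>The induction adds the indices of \<open>D\<close> to \<open>A\<close> one by
    one; at \<open>D = B\<close> the union is \<open>B\<close>.\<close>
  have "norm (\<Sum>i\<in>A. c i *\<^sub>R ?x i) \<le> norm (\<Sum>i\<in>A \<union> D. c i *\<^sub>R ?x i)"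
    if "finite D" "D \<subseteq> B" for D
    using that
  proof (induction D)
    case (insert \<alpha> D)
    then have IH: "norm (\<Sum>i\<in>A. c i *\<^sub>R ?x i) \<le> norm (\<Sum>i\<in>A \<union> D. c i *\<^sub>R ?x i)"
      by simp
    show ?case
    proof (cases "\<alpha> \<in> A")
      case True
      with IH show ?thesis by (simp add: insert_absorb)
    next
      case False
      have "norm (\<Sum>i\<in>A \<union> D. c i *\<^sub>R ?x i) \<le> norm (\<Sum>i\<in>insert \<alpha> (A \<union> D). c i *\<^sub>R ?x i)"
        using insert AB False by (intro drop) (auto intro: finite_subset)
      with IH show ?thesis by simp
    qed
  qed simp
  from this[of B] AB show "norm (\<Sum>i\<in>A. c i *\<^sub>R ?x i) \<le> norm (\<Sum>i\<in>B. c i *\<^sub>R ?x i)"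
    by (simp add: Un_absorb1)
qed

theorem proposition4p1:
  fixes \<kappa> :: "'k rel"
  assumes "infinite_dimensional TYPE('a::banach)"
    and "Card_order \<kappa>" and "uncountable (Field \<kappa>)" and "regularCard \<kappa>"
  shows "(\<exists>e :: 'k \<Rightarrow> 'a. suppression_unconditional_basic \<kappa> e)
    \<longleftrightarrow> (\<exists>\<sigma> :: ('k, 'a) strategy. winning_strategy \<kappa> \<sigma>)"
proof
  have \<kappa>: "Well_order \<kappa>"
    using assms(2) by (rule card_order_on_well_order_on)
  show "\<exists>\<sigma> :: ('k, 'a) strategy. winning_strategy \<kappa> \<sigma>"
    if "\<exists>e :: 'k \<Rightarrow> 'a. suppression_unconditional_basic \<kappa> e"
    using that winning_strategyI[OF \<kappa> assms(3)] by blast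
  show "\<exists>e :: 'k \<Rightarrow> 'a. suppression_unconditional_basic \<kappa> e"
    if "\<exists>\<sigma> :: ('k, 'a) strategy. winning_strategy \<kappa> \<sigma>"
  proof -
    obtain \<sigma> :: "('k, 'a) strategy" where "winning_strategy \<kappa> \<sigma>"
      using \<open>\<exists>\<sigma>. winning_strategy \<kappa> \<sigma>\<close> by blast
    \<comment> \<open>Winning is a statement about all plays that follow \<sigma>, so one such play
      has to be produced.\<close>
    moreover obtain p where "follows \<kappa> \<sigma> p"
      using follows_exists[OF \<kappa>] by blast
    ultimately have "legal_inning \<kappa> p \<alpha> (p \<alpha>)" if "\<alpha> \<in> Field \<kappa>" for \<alpha>
      using that by (simp add: winning_strategy_def)
    then show ?thesis
      using suppression_unconditional_of_play[OF \<kappa>] by blast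
  qed
qed

end
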